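(* For all $n\ge1$ and $0\le k\le n$, $R_{k,2n}=\binom{n}{k}^2(n!)^2$.
   Context: $\mathcal{S}_m$ denotes the set of permutations $\sigma=\sigma_1\cdots\sigma_m$ of $\{1,\dots,m\}$. $\overleftarrow{des}_E(\sigma)$ is the number of indices $i\in\{1,\dots,m-1\}$ with $\sigma_i>\sigma_{i+1}$ and $\sigma_i$ even. $R_{k,m}$ denotes the number of $\sigma\in\mathcal{S}_m$ with $\overleftarrow{des}_E(\sigma)=k$. *)

theory Defs
  imports "HOL-Combinatorics.Permutations"
begin

text \<open>A permutation \<open>\<sigma>\<^sub>1 \<dots> \<sigma>\<^sub>m\<close> of \<open>{1, \<dots>, m}\<close> is a function \<open>\<sigma>\<close> with
  \<open>\<sigma> permutes {1..m}\<close>, its \<open>i\<close>-th letter being \<open>\<sigma> i\<close>. Since \<open>permutes\<close> forces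
  \<open>\<sigma>\<close> to be the identity outside \<open>{1..m}\<close>, each permutation is counted exactly once.\<close>

definition des_E :: "nat \<Rightarrow> (nat \<Rightarrow> nat) \<Rightarrow> nat" where
  "des_E m \<sigma> = card {i \<in> {1..<m}. \<sigma> i > \<sigma> (i + 1) \<and> even (\<sigma> i)}"

definition R :: "nat \<Rightarrow> nat \<Rightarrow> nat" where
  "R k m = card {\<sigma>. \<sigma> permutes {1..m} \<and> des_E m \<sigma> = k}"

end

theory Submission
  imports Defs "HOL-Combinatorics.Multiset_Permutations"
begin

text \<open>Build permutations by inserting the largest letter \<open>a\<close> into a gap of a shorter one. The letter
  in front of \<open>a\<close> is no longer a descent top, and \<open>a\<close> itself becomes one unless it is put at the end.
  Let a word of length \<open>m\<close> have \<open>d\<close> descents with even top. If \<open>a\<close> is odd, then \<open>d\<close> of the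
  \<open>m + 1\<close> gaps lead to \<open>d - 1\<close> descents and the others to \<open>d\<close>; if \<open>a\<close> is even, then \<open>d + 1\<close> of
  the gaps lead to \<open>d\<close> descents and the others to \<open>d + 1\<close>. The resulting recurrences are solved by
  the claimed formula together with \<open>R k (2n + 1) = (k + 1) (n + 1 choose k + 1)\<^sup>2 (n!)\<^sup>2\<close>,
  and both verifications come down to \<open>(n - k)\<^sup>2 + (k + 1) (2n + 1 - k) = (n + 1)\<^sup>2\<close>.\<close>

text \<open>Gap \<open>j\<close> precedes \<open>xs ! j\<close>, and a descent is identified with the gap between its two letters.\<close>

definition descents :: "('a::linorder \<Rightarrow> bool) \<Rightarrow> 'a list \<Rightarrow> nat set" where
  "descents P xs = {j \<in> {0<..<length xs}. xs ! j < xs ! (j - 1) \<and> P (xs ! (j - 1))}"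

definition insert_at :: "nat \<Rightarrow> 'a \<Rightarrow> 'a list \<Rightarrow> 'a list" where
  "insert_at j a xs = take j xs @ a # drop j xs"

definition permutations_with_descents ::
  "('a::linorder \<Rightarrow> bool) \<Rightarrow> nat \<Rightarrow> 'a set \<Rightarrow> 'a list set" where
  "permutations_with_descents P k A = {xs \<in> permutations_of_set A. card (descents P xs) = k}"

lemma descents_subset: "descents P xs \<subseteq> {..<length xs}"
  by (auto simp: descents_def)

lemma finite_descents [simp]: "finite (descents P xs)"
  using descents_subset finite_lessThan by (rule finite_subset)

lemma length_insert_at [simp]: "j \<le> length xs \<Longrightarrow> length (insert_at j a xs) = Suc (length xs)"
  by (simp add: insert_at_def)

lemma nth_insert_at:
  assumes "j \<le> length xs"
  shows "insert_at j a xs ! i = (if i < j then xs ! i else if i = j then a else xs ! (i - 1))"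
  using assms by (simp add: insert_at_def nth_append nth_Cons')

lemma descents_insert_at:
  assumes j: "j \<le> length xs" and max: "\<forall>x\<in>set xs. x < a"
  shows "descents P (insert_at j a xs) =
    {i \<in> descents P xs. i < j} \<union> {i. i = Suc j \<and> j < length xs \<and> P a} \<union>
    Suc ` {i \<in> descents P xs. j < i}" (is "_ = ?D")
proof (rule set_eqI)
  fix i
  have below: "xs ! l < a" if "l < length xs" for l
    using max that by simp
  then have not_above: "\<not> a < xs ! l" if "l < length xs" for l
    using that less_asym by blast
  consider "i < j" | "i = j" | "i = Suc j" | l where "i = Suc l" "j < l"
    by (metis Suc_lessI linorder_neqE_nat Suc_lessE)
  then show "i \<in> descents P (insert_at j a xs) \<longleftrightarrow> i \<in> ?D"
    using j below not_above by cases (auto simp: descents_def nth_insert_at)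
qed

lemma card_descents_insert_at:
  assumes j: "j \<le> length xs" and max: "\<forall>x\<in>set xs. x < a"
  shows "card (descents P (insert_at j a xs)) + of_bool (j \<in> descents P xs) =
    card (descents P xs) + of_bool (j < length xs \<and> P a)"
proof -
  define before broken after where "before = {i \<in> descents P xs. i < j}"
    and "broken = {i \<in> descents P xs. i = j}" and "after = {i \<in> descents P xs. j < i}"
  define created where "created = {i. i = Suc j \<and> j < length xs \<and> P a}"
  have finite: "finite before" "finite broken" "finite after" "finite created"
    by (simp_all add: before_def broken_def after_def created_def)
  have disjoint: "before \<inter> broken = {}" "(before \<union> broken) \<inter> after = {}"
    "before \<inter> created = {}" "(before \<union> created) \<inter> Suc ` after = {}"
    by (auto simp: before_def broken_def after_def created_def)
  have "descents P (insert_at j a xs) = before \<union> created \<union> Suc ` after"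
    unfolding before_def created_def after_def by (rule descents_insert_at[OF assms])
  then have "card (descents P (insert_at j a xs)) = card before + card created + card after"
    using finite disjoint by (simp add: card_Un_disjoint card_image)
  moreover have "card created = of_bool (j < length xs \<and> P a)"
    by (simp add: created_def)
  moreover have "descents P xs = before \<union> broken \<union> after"
    using linorder_neq_iff[of _ j] by (auto simp: before_def broken_def after_def)
  then have "card (descents P xs) = card before + card broken + card after"
    using finite disjoint by (simp add: card_Un_disjoint)
  moreover have "broken = (if j \<in> descents P xs then {j} else {})"
    by (auto simp: broken_def)
  ultimately show ?thesis
    by simp
qed

lemma card_insertions_with_descents:
  assumes max: "\<forall>x\<in>set xs. x < a"
  shows "card {j \<in> {..length xs}. card (descents P (insert_at j a xs)) = k} =
    Suc k * of_bool (card (descents P xs) + of_bool (P a) = Suc k) +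
    (Suc (length xs) - k) * of_bool (card (descents P xs) + of_bool (P a) = k)"
proof -
  \<comment> \<open>The gaps that lead to one descent fewer than the others.\<close>
  define low_gaps where "low_gaps = descents P xs \<union> {j. j = length xs \<and> P a}"
  have "length xs \<notin> descents P xs"
    by (simp add: descents_def)
  then have card_low_gaps: "card low_gaps = card (descents P xs) + of_bool (P a)"
    unfolding low_gaps_def by (subst card_Un_disjoint) auto
  have low_gaps_subset: "low_gaps \<subseteq> {..length xs}"
    using descents_subset[of P xs] by (auto simp: low_gaps_def)
  have "card (descents P (insert_at j a xs)) + of_bool (j \<in> low_gaps) = card low_gaps"
    if "j \<le> length xs" for j
    using card_descents_insert_at[OF that max, of P] that \<open>length xs \<notin> descents P xs\<close>
    unfolding card_low_gaps by (auto simp: low_gaps_def)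
  then have "{j \<in> {..length xs}. card (descents P (insert_at j a xs)) = k} =
      {j \<in> {..length xs}. k + of_bool (j \<in> low_gaps) = card low_gaps}"
    by fastforce
  also have "\<dots> = (if card low_gaps = Suc k then low_gaps
      else if card low_gaps = k then {..length xs} - low_gaps else {})"
    using low_gaps_subset by auto
  also have "card \<dots> = Suc k * of_bool (card low_gaps = Suc k) +
      (Suc (length xs) - k) * of_bool (card low_gaps = k)"
    using low_gaps_subset by (auto simp: card_Diff_subset finite_subset)
  finally show ?thesis
    unfolding card_low_gaps .
qed

lemma bij_betw_insert_at:
  assumes "finite A" and "a \<notin> A"
  shows "bij_betw (\<lambda>(xs, j). insert_at j a xs)
    (permutations_of_set A \<times> {..card A}) (permutations_of_set (insert a A))"
proof (rule bij_betw_imageI)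
  have avoids: "a \<notin> set (take j xs)" "a \<notin> set (drop j xs)" if "xs \<in> permutations_of_set A" for xs j
    using that assms(2) by (auto dest: in_set_takeD in_set_dropD permutations_of_setD(1))
  show "inj_on (\<lambda>(xs, j). insert_at j a xs) (permutations_of_set A \<times> {..card A})"
  proof (intro inj_onI, clarify)
    fix xs i ys j
    assume xs: "xs \<in> permutations_of_set A" "i \<le> card A"
      and ys: "ys \<in> permutations_of_set A" "j \<le> card A"
      and "insert_at i a xs = insert_at j a ys"
    then have "take i xs = take j ys" "drop i xs = drop j ys"
      using avoids by (simp_all add: insert_at_def append_Cons_eq_iff)
    moreover have "length xs = card A" "length ys = card A"
      using xs ys by (simp_all add: length_finite_permutations_of_set)
    ultimately show "xs = ys \<and> i = j"
      using xs(2) ys(2) by (metis append_take_drop_id length_take min.absorb2)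
  qed
  show "(\<lambda>(xs, j). insert_at j a xs) ` (permutations_of_set A \<times> {..card A}) =
    permutations_of_set (insert a A)"
  proof (intro equalityI subsetI)
    fix zs assume "zs \<in> (\<lambda>(xs, j). insert_at j a xs) ` (permutations_of_set A \<times> {..card A})"
    then obtain xs j where zs: "zs = insert_at j a xs" and xs: "xs \<in> permutations_of_set A"
      by auto
    have "mset zs = add_mset a (mset xs)"
      using mset_append[of "take j xs" "drop j xs"] by (simp add: zs insert_at_def)
    then show "zs \<in> permutations_of_set (insert a A)"
      using xs assms by (simp add: permutations_of_set_altdef permutations_of_multiset_def)
  next
    fix zs assume zs: "zs \<in> permutations_of_set (insert a A)"
    then obtain us vs where split: "zs = us @ a # vs"
      by (metis permutations_of_setD(1) insertI1 split_list)
    have perm: "us @ vs \<in> permutations_of_set A"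
      using zs assms unfolding split
      by (simp add: permutations_of_set_altdef permutations_of_multiset_def)
    have "zs = insert_at (length us) a (us @ vs)"
      by (simp add: split insert_at_def)
    moreover have "length us \<le> card A"
      using length_finite_permutations_of_set[OF perm] by simp
    ultimately show "zs \<in> (\<lambda>(xs, j). insert_at j a xs) ` (permutations_of_set A \<times> {..card A})"
      using perm by auto
  qed
qed

lemma card_permutations_with_descents_insert:
  assumes fin: "finite A" and max: "\<forall>x\<in>A. x < a"
  shows "card (permutations_with_descents P k (insert a A)) =
    Suc k * card {xs \<in> permutations_of_set A. card (descents P xs) + of_bool (P a) = Suc k} +
    (Suc (card A) - k) * card {xs \<in> permutations_of_set A. card (descents P xs) + of_bool (P a) = k}"
proof -
  let ?insert = "\<lambda>(xs, j). insert_at j a xs"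
  let ?gaps = "\<lambda>xs. {j \<in> {..length xs}. card (descents P (insert_at j a xs)) = k}"
  have "a \<notin> A"
    using max by blast
  then have "bij_betw ?insert
      {p \<in> permutations_of_set A \<times> {..card A}. card (descents P (?insert p)) = k}
      (permutations_with_descents P k (insert a A))"
    unfolding permutations_with_descents_def
    by (intro bij_betw_Collect bij_betw_insert_at fin refl)
  also have "{p \<in> permutations_of_set A \<times> {..card A}. card (descents P (?insert p)) = k} =
      Sigma (permutations_of_set A) ?gaps"
    by (auto simp: length_finite_permutations_of_set)
  finally have "card (permutations_with_descents P k (insert a A)) =
      (\<Sum>xs\<in>permutations_of_set A. card (?gaps xs))"
    by (simp add: bij_betw_same_card[symmetric])
  also have "\<dots> = (\<Sum>xs\<in>permutations_of_set A.
      Suc k * of_bool (card (descents P xs) + of_bool (P a) = Suc k) +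
      (Suc (card A) - k) * of_bool (card (descents P xs) + of_bool (P a) = k))"
    using max by (intro sum.cong refl, subst card_insertions_with_descents)
      (auto simp: length_finite_permutations_of_set dest: permutations_of_setD)
  finally show ?thesis
    by (simp add: sum.distrib Int_def del: mult_Suc flip: sum_distrib_left)
qed

lemma bij_betw_map_permutes:
  assumes "distinct xs"
  shows "bij_betw (\<lambda>\<sigma>. map \<sigma> xs) {\<sigma>. \<sigma> permutes set xs} (permutations_of_set (set xs))"
proof (rule bij_betw_imageI)
  show inj: "inj_on (\<lambda>\<sigma>. map \<sigma> xs) {\<sigma>. \<sigma> permutes set xs}"
  proof (rule inj_onI)
    fix \<sigma> \<tau>
    assume "\<sigma> \<in> {\<sigma>. \<sigma> permutes set xs}" "\<tau> \<in> {\<sigma>. \<sigma> permutes set xs}"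
      and "map \<sigma> xs = map \<tau> xs"
    then show "\<sigma> = \<tau>"
      by (metis ext map_eq_conv mem_Collect_eq permutes_not_in)
  qed
  have "(\<lambda>\<sigma>. map \<sigma> xs) ` {\<sigma>. \<sigma> permutes set xs} \<subseteq> permutations_of_set (set xs)"
    using assms by (auto simp: permutations_of_set_def distinct_map permutes_image permutes_inj_on)
  then show "(\<lambda>\<sigma>. map \<sigma> xs) ` {\<sigma>. \<sigma> permutes set xs} = permutations_of_set (set xs)"
    by (rule card_subset_eq[rotated]) (simp_all add: card_image[OF inj] card_permutations)
qed

lemma descents_map_upt:
  "descents P (map \<sigma> [1..<Suc m]) = {i \<in> {1..<m}. \<sigma> i > \<sigma> (i + 1) \<and> P (\<sigma> i)}"
  by (auto simp: descents_def simp del: upt_Suc)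

lemma R_eq_card_permutations_with_descents:
  "R k m = card (permutations_with_descents even k {1..m})"
proof -
  have "set [1..<Suc m] = {1..m}"
    by auto
  then have "bij_betw (\<lambda>\<sigma>. map \<sigma> [1..<Suc m]) {\<sigma>. \<sigma> permutes {1..m}} (permutations_of_set {1..m})"
    using bij_betw_map_permutes[of "[1..<Suc m]"] by (simp del: upt_Suc)
  then have "bij_betw (\<lambda>\<sigma>. map \<sigma> [1..<Suc m]) {\<sigma> \<in> {\<sigma>. \<sigma> permutes {1..m}}. des_E m \<sigma> = k}
      (permutations_with_descents even k {1..m})"
    unfolding permutations_with_descents_def
    by (rule bij_betw_Collect) (simp add: des_E_def descents_map_upt del: upt_Suc One_nat_def)
  then show ?thesis
    unfolding R_def by (simp add: bij_betw_same_card)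
qed

lemma R_0_right: "R k 0 = of_bool (k = 0)"
  by (simp add: R_def des_E_def)

lemma R_Suc_even:
  assumes "even m"
  shows "R k (Suc m) = Suc k * R (Suc k) m + (Suc m - k) * R k m"
  using card_permutations_with_descents_insert[of "{1..m}" "Suc m" even k] assms
  by (simp add: R_eq_card_permutations_with_descents permutations_with_descents_def
      atLeastAtMostSuc_conv del: mult_Suc)

lemma R_0_Suc_odd:
  assumes "odd m"
  shows "R 0 (Suc m) = R 0 m"
  using card_permutations_with_descents_insert[of "{1..m}" "Suc m" even 0] assms
  by (simp add: R_eq_card_permutations_with_descents permutations_with_descents_def
      atLeastAtMostSuc_conv)

lemma R_Suc_Suc_odd:
  assumes "odd m"
  shows "R (Suc k) (Suc m) = Suc (Suc k) * R (Suc k) m + (m - k) * R k m"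
  using card_permutations_with_descents_insert[of "{1..m}" "Suc m" even "Suc k"] assms
  by (simp add: R_eq_card_permutations_with_descents permutations_with_descents_def
      atLeastAtMostSuc_conv del: mult_Suc)

lemma Suc_times_choose_Suc: "Suc k * (n choose Suc k) = (n - k) * (n choose k)"
  by (metis binomial_absorb_comp binomial_absorption)

lemma square_diff_add_times_Suc:
  fixes k n :: nat
  assumes "k \<le> n"
  shows "(n - k)\<^sup>2 + Suc k * (Suc (2 * n) - k) = (Suc n)\<^sup>2"
proof -
  obtain r where "n = k + r"
    using assms le_Suc_ex by blast
  moreover from this have "Suc (2 * n) - k = Suc (k + 2 * r)"
    by simp
  ultimately show ?thesis
    by (simp add: power2_eq_square algebra_simps)
qed

lemma choose_squares_even_step:
  "Suc k * (n choose Suc k)\<^sup>2 + (Suc (2 * n) - k) * (n choose k)\<^sup>2 =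
    Suc k * (Suc n choose Suc k)\<^sup>2"
proof (cases "k \<le> n")
  case True
  have "Suc k * (Suc k * (n choose Suc k)\<^sup>2 + (Suc (2 * n) - k) * (n choose k)\<^sup>2) =
      (Suc k * (n choose Suc k))\<^sup>2 + Suc k * (Suc (2 * n) - k) * (n choose k)\<^sup>2"
    by (simp only: power2_eq_square distrib_left mult_ac)
  also have "\<dots> = ((n - k)\<^sup>2 + Suc k * (Suc (2 * n) - k)) * (n choose k)\<^sup>2"
    by (simp only: Suc_times_choose_Suc power_mult_distrib distrib_right)
  also have "\<dots> = (Suc k * (Suc n choose Suc k))\<^sup>2"
    by (simp only: square_diff_add_times_Suc[OF True] Suc_times_binomial power_mult_distrib)
  also have "\<dots> = Suc k * (Suc k * (Suc n choose Suc k)\<^sup>2)"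
    by (simp only: power2_eq_square mult_ac)
  finally show ?thesis
    by (simp only: mult_cancel1) simp
qed (simp add: binomial_eq_0)

lemma choose_squares_odd_step:
  "(Suc (Suc k))\<^sup>2 * (Suc n choose Suc (Suc k))\<^sup>2 +
    Suc k * (Suc (2 * n) - k) * (Suc n choose Suc k)\<^sup>2 = (Suc n)\<^sup>2 * (Suc n choose Suc k)\<^sup>2"
proof (cases "k \<le> n")
  case True
  have "Suc (Suc k) * (Suc n choose Suc (Suc k)) = (n - k) * (Suc n choose Suc k)"
    by (simp only: Suc_times_choose_Suc diff_Suc_Suc)
  then show ?thesis
    by (simp only: square_diff_add_times_Suc[OF True, symmetric] distrib_right
        flip: power_mult_distrib)
qed (simp add: binomial_eq_0)

lemma R_odd_of_R_even:
  assumes "\<And>k. R k (2 * n) = (n choose k)\<^sup>2 * (fact n)\<^sup>2"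
  shows "R k (Suc (2 * n)) = Suc k * (Suc n choose Suc k)\<^sup>2 * (fact n)\<^sup>2"
proof -
  have "R k (Suc (2 * n)) =
      (Suc k * (n choose Suc k)\<^sup>2 + (Suc (2 * n) - k) * (n choose k)\<^sup>2) * (fact n)\<^sup>2"
    by (simp only: R_Suc_even[of "2 * n"] dvd_triv_left assms distrib_right mult.assoc)
  then show ?thesis
    by (simp only: choose_squares_even_step)
qed

lemma R_even_of_R_odd:
  assumes "\<And>k. R k (Suc (2 * n)) = Suc k * (Suc n choose Suc k)\<^sup>2 * (fact n)\<^sup>2"
  shows "R k (2 * Suc n) = (Suc n choose k)\<^sup>2 * (fact (Suc n))\<^sup>2"
proof (cases k)
  case 0
  have "R 0 (2 * Suc n) = R 0 (Suc (2 * n))"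
    using R_0_Suc_odd[of "Suc (2 * n)"] by simp
  then show ?thesis
    using 0 by (simp add: assms power_mult_distrib del: mult_Suc)
next
  case (Suc i)
  have "R (Suc i) (2 * Suc n) =
      Suc (Suc i) * R (Suc i) (Suc (2 * n)) + (Suc (2 * n) - i) * R i (Suc (2 * n))"
    using R_Suc_Suc_odd[of "Suc (2 * n)" i] by simp
  also have "\<dots> = ((Suc (Suc i))\<^sup>2 * (Suc n choose Suc (Suc i))\<^sup>2 +
      Suc i * (Suc (2 * n) - i) * (Suc n choose Suc i)\<^sup>2) * (fact n)\<^sup>2"
    unfolding assms by (simp only: power2_eq_square distrib_left distrib_right mult_ac)
  also have "\<dots> = (Suc n choose Suc i)\<^sup>2 * (fact (Suc n))\<^sup>2"
    unfolding choose_squares_odd_step fact_Suc of_nat_id by (simp only: power_mult_distrib mult_ac)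
  finally show ?thesis
    by (simp only: Suc)
qed

theorem theorem3p4:
  fixes n k :: nat
  assumes "n \<ge> 1" and "k \<le> n"
  shows "R k (2 * n) = (n choose k)\<^sup>2 * (fact n)\<^sup>2"
proof (induction n arbitrary: k)
  case 0
  show ?case
    by (cases k) (simp_all add: R_0_right)
next
  case (Suc n)
  show ?case
    by (intro R_even_of_R_odd R_odd_of_R_even Suc.IH)
qed

end
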